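(* Let $\mathbf{A}=(A;\wedge,\to,\neg,\top)$ be a CN-algebra, and put $\Diamond x:=x\wedge\top$ and $\Diamond(\mathbf{A}):=(\Diamond[A];\wedge,\vee,\to,\top)$. Then $\mathbf{A}$ is isomorphic to a CN-twist-algebra over $\Diamond(\mathbf{A})$, as witnessed by the map $\iota\colon\mathbf{A}\to\Diamond(\mathbf{A})\times\Diamond(\mathbf{A})$, $a\mapsto(\Diamond a,\Diamond\neg a)$.
   Context: A De Morgan lattice is a distributive lattice with a unary operation $\neg$ satisfying $\neg\neg a=a$ and $\neg(a\wedge b)=\neg a\vee\neg b$. A Kleene algebra (or Kleene lattice) is a De Morgan lattice (not necessarily bounded) satisfying $\neg a\wedge a\le\neg b\vee b$; it is centered, with center $\top$, if $\neg\top=\top$. A CN-algebra is an algebra $(A;\wedge,\to,\neg,\top)$ such that $(A;\wedge,\neg,\top)$ is a centered Kleene lattice (with $x\vee y:=\neg(\neg x\wedge\neg y)$) and, with $\Diamond x:=x\wedge\top$: (CN1) $(x\wedge y)\to z=x\to(y\to z)$; (CN2) $\top\le x\to(y\to y)$; (CN3) $\top\le((x\to y)\to x)\to x$; (CN4) $\Diamond(x\to y)=\Diamond x\to\Diamond y$; (CN5) $\neg(x\to y)=x\to\neg y$; (CN6) $\Diamond(x\wedge y)=\Diamond(x\wedge(x\to y))$. $\Diamond(\mathbf{A})$ carries the operations of $\mathbf{A}$ restricted to $\Diamond[A]=\{a\wedge\top: a\in A\}$; it is a generalized Boolean algebra with greatest element $\top$. A generalized Boolean algebra is an algebra $(B;\wedge,\vee,\to,1)$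 such that $(B;\wedge,\vee,1)$ is a lattice with greatest element $1$, $x\wedge y\le z$ iff $y\le x\to z$, and $(x\to y)\to x=x$. For a generalized Boolean algebra $\mathbf{B}$, the full CN-twist-algebra $\mathbf{B}^{\bowtie}$ has universe $\{(a_1,a_2)\in B\times B:a_1\vee a_2=1\}$ and operations $(x_1,x_2)\wedge(y_1,y_2):=(x_1\wedge y_1,x_2\vee y_2)$, $\neg(x_1,x_2):=(x_2,x_1)$, $\top:=(1,1)$, $(x_1,x_2)\to(y_1,y_2):=(x_1\to y_1,x_1\to y_2)$. A CN-twist-algebra over $\mathbf{B}$ is any subalgebra $\mathbf{C}\leqslant\mathbf{B}^{\bowtie}$ such that $\pi_1[C]=B$, where $\pi_1$ is the first projection. *)

theory Defs
  imports "HOL-Algebra.Congruence"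
begin

locale lattice_on =
  fixes L :: "'a set" and meet :: "'a \<Rightarrow> 'a \<Rightarrow> 'a" and join :: "'a \<Rightarrow> 'a \<Rightarrow> 'a"
  assumes meet_closed: "x \<in> L \<Longrightarrow> y \<in> L \<Longrightarrow> meet x y \<in> L"
    and join_closed: "x \<in> L \<Longrightarrow> y \<in> L \<Longrightarrow> join x y \<in> L"
    and meet_comm: "x \<in> L \<Longrightarrow> y \<in> L \<Longrightarrow> meet x y = meet y x"
    and join_comm: "x \<in> L \<Longrightarrow> y \<in> L \<Longrightarrow> join x y = join y x"
    and meet_assoc:
      "x \<in> L \<Longrightarrow> y \<in> L \<Longrightarrow> z \<in> L \<Longrightarrow> meet (meet x y) z = meet x (meet y z)"
    and join_assoc:
      "x \<in> L \<Longrightarrow> y \<in> L \<Longrightarrow> z \<in> L \<Longrightarrow> join (join x y) z = join x (join y z)"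
    and meet_absorb: "x \<in> L \<Longrightarrow> y \<in> L \<Longrightarrow> meet x (join x y) = x"
    and join_absorb: "x \<in> L \<Longrightarrow> y \<in> L \<Longrightarrow> join x (meet x y) = x"

locale distrib_lattice_on = lattice_on +
  assumes distrib:
    "x \<in> L \<Longrightarrow> y \<in> L \<Longrightarrow> z \<in> L \<Longrightarrow> meet x (join y z) = join (meet x y) (meet x z)"

locale de_morgan_lattice_on = distrib_lattice_on +
  fixes neg :: "'a \<Rightarrow> 'a"
  assumes neg_closed: "x \<in> L \<Longrightarrow> neg x \<in> L"
    and neg_neg: "x \<in> L \<Longrightarrow> neg (neg x) = x"
    and de_morgan: "x \<in> L \<Longrightarrow> y \<in> L \<Longrightarrow> neg (meet x y) = join (neg x) (neg y)"

text \<open>Inequalities refer to the lattice order, in which \<open>x \<le> y\<close> means \<open>x \<and> y = x\<close>.\<close>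

definition meet_le :: "('a \<Rightarrow> 'a \<Rightarrow> 'a) \<Rightarrow> 'a \<Rightarrow> 'a \<Rightarrow> bool" where
  "meet_le meet x y \<longleftrightarrow> meet x y = x"

locale kleene_lattice_on = de_morgan_lattice_on +
  assumes kleene:
    "x \<in> L \<Longrightarrow> y \<in> L \<Longrightarrow> meet_le meet (meet (neg x) x) (join (neg y) y)"

locale centered_kleene_lattice_on = kleene_lattice_on +
  fixes center :: 'a
  assumes center_closed: "center \<in> L"
    and neg_center: "neg center = center"

text \<open>
  Records collect the signatures. The operations are total functions on the underlying type
  and are only meaningful on the carrier. Note that in a CN-algebra \<open>\<top>\<close> denotes the center,
  not a greatest element, whereas in a generalized Boolean algebra it is the greatest element.
\<close>

record 'a meet_imp = "'a partial_object" +
  meet :: "'a \<Rightarrow> 'a \<Rightarrow> 'a" (infixl \<open>\<sqinter>\<index>\<close> 70)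
  imp :: "'a \<Rightarrow> 'a \<Rightarrow> 'a" (infixr \<open>\<leadsto>\<index>\<close> 60)
  tt :: 'a (\<open>\<top>\<index>\<close>)

record 'a cn_struct = "'a meet_imp" +
  neg :: "'a \<Rightarrow> 'a" (\<open>\<sim>\<index> _\<close> [81] 80)

record 'a gba_struct = "'a meet_imp" +
  gjoin :: "'a \<Rightarrow> 'a \<Rightarrow> 'a" (infixl \<open>\<squnion>\<index>\<close> 65)

definition le :: "('a, 'b) meet_imp_scheme \<Rightarrow> 'a \<Rightarrow> 'a \<Rightarrow> bool" (infix \<open>\<sqsubseteq>\<index>\<close> 50) where
  "x \<sqsubseteq>\<^bsub>M\<^esub> y \<longleftrightarrow> meet_le (meet M) x y"

definition cn_join :: "('a, 'b) cn_struct_scheme \<Rightarrow> 'a \<Rightarrow> 'a \<Rightarrow> 'a" where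
  "cn_join M x y = \<sim>\<^bsub>M\<^esub> (\<sim>\<^bsub>M\<^esub> x \<sqinter>\<^bsub>M\<^esub> \<sim>\<^bsub>M\<^esub> y)"

definition diamond :: "('a, 'b) cn_struct_scheme \<Rightarrow> 'a \<Rightarrow> 'a" (\<open>\<diamond>\<index> _\<close> [81] 80) where
  "\<diamond>\<^bsub>M\<^esub> x = x \<sqinter>\<^bsub>M\<^esub> \<top>\<^bsub>M\<^esub>"

locale cn_algebra =
  fixes M (structure)
  assumes centered_kleene:
      "centered_kleene_lattice_on (carrier M) (meet M) (cn_join M) (neg M) \<top>"
    and imp_closed: "x \<in> carrier M \<Longrightarrow> y \<in> carrier M \<Longrightarrow> x \<leadsto> y \<in> carrier M"
    and CN1: "x \<in> carrier M \<Longrightarrow> y \<in> carrier M \<Longrightarrow> z \<in> carrier M \<Longrightarrow>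
      (x \<sqinter> y) \<leadsto> z = x \<leadsto> (y \<leadsto> z)"
    and CN2: "x \<in> carrier M \<Longrightarrow> y \<in> carrier M \<Longrightarrow> \<top> \<sqsubseteq> x \<leadsto> (y \<leadsto> y)"
    and CN3: "x \<in> carrier M \<Longrightarrow> y \<in> carrier M \<Longrightarrow> \<top> \<sqsubseteq> ((x \<leadsto> y) \<leadsto> x) \<leadsto> x"
    and CN4: "x \<in> carrier M \<Longrightarrow> y \<in> carrier M \<Longrightarrow> \<diamond> (x \<leadsto> y) = \<diamond> x \<leadsto> \<diamond> y"
    and CN5: "x \<in> carrier M \<Longrightarrow> y \<in> carrier M \<Longrightarrow> \<sim> (x \<leadsto> y) = x \<leadsto> \<sim> y"
    and CN6: "x \<in> carrier M \<Longrightarrow> y \<in> carrier M \<Longrightarrow> \<diamond> (x \<sqinter> y) = \<diamond> (x \<sqinter> (x \<leadsto> y))"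

locale generalized_boolean_algebra =
  fixes B (structure)
  assumes lattice: "lattice_on (carrier B) (meet B) (gjoin B)"
    and imp_closed: "x \<in> carrier B \<Longrightarrow> y \<in> carrier B \<Longrightarrow> x \<leadsto> y \<in> carrier B"
    and one_closed: "\<top> \<in> carrier B"
    and one_greatest: "x \<in> carrier B \<Longrightarrow> x \<sqsubseteq> \<top>"
    and residuation: "x \<in> carrier B \<Longrightarrow> y \<in> carrier B \<Longrightarrow> z \<in> carrier B \<Longrightarrow>
      x \<sqinter> y \<sqsubseteq> z \<longleftrightarrow> y \<sqsubseteq> x \<leadsto> z"
    and peirce: "x \<in> carrier B \<Longrightarrow> y \<in> carrier B \<Longrightarrow> (x \<leadsto> y) \<leadsto> x = x"

definition diamond_algebra :: "('a, 'b) cn_struct_scheme \<Rightarrow> 'a gba_struct" where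
  "diamond_algebra A = \<lparr> carrier = diamond A ` carrier A,
    meet = meet A, imp = imp A, tt = \<top>\<^bsub>A\<^esub>, gjoin = cn_join A \<rparr>"

definition full_twist :: "('a, 'b) gba_struct_scheme \<Rightarrow> ('a \<times> 'a) cn_struct" where
  "full_twist B = \<lparr>
    carrier = {(a1, a2). a1 \<in> carrier B \<and> a2 \<in> carrier B \<and> a1 \<squnion>\<^bsub>B\<^esub> a2 = \<top>\<^bsub>B\<^esub>},
    meet = (\<lambda>(x1, x2) (y1, y2). (x1 \<sqinter>\<^bsub>B\<^esub> y1, x2 \<squnion>\<^bsub>B\<^esub> y2)),
    imp = (\<lambda>(x1, x2) (y1, y2). (x1 \<leadsto>\<^bsub>B\<^esub> y1, x1 \<leadsto>\<^bsub>B\<^esub> y2)),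
    tt = (\<top>\<^bsub>B\<^esub>, \<top>\<^bsub>B\<^esub>),
    neg = (\<lambda>(x1, x2). (x2, x1)) \<rparr>"

definition cn_subalgebra ::
    "('a, 'b) cn_struct_scheme \<Rightarrow> ('a, 'c) cn_struct_scheme \<Rightarrow> bool" where
  "cn_subalgebra C M \<longleftrightarrow>
    carrier C \<subseteq> carrier M \<and>
    (\<forall>x\<in>carrier C. \<forall>y\<in>carrier C.
      x \<sqinter>\<^bsub>C\<^esub> y = x \<sqinter>\<^bsub>M\<^esub> y \<and> x \<sqinter>\<^bsub>M\<^esub> y \<in> carrier C \<and>
      x \<leadsto>\<^bsub>C\<^esub> y = x \<leadsto>\<^bsub>M\<^esub> y \<and> x \<leadsto>\<^bsub>M\<^esub> y \<in> carrier C) \<and>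
    (\<forall>x\<in>carrier C. \<sim>\<^bsub>C\<^esub> x = \<sim>\<^bsub>M\<^esub> x \<and> \<sim>\<^bsub>M\<^esub> x \<in> carrier C) \<and>
    \<top>\<^bsub>C\<^esub> = \<top>\<^bsub>M\<^esub> \<and> \<top>\<^bsub>M\<^esub> \<in> carrier C"

definition cn_twist_algebra_over ::
    "('a \<times> 'a) cn_struct \<Rightarrow> 'a gba_struct \<Rightarrow> bool" where
  "cn_twist_algebra_over C B \<longleftrightarrow>
    generalized_boolean_algebra B \<and> cn_subalgebra C (full_twist B) \<and> fst ` carrier C = carrier B"

definition cn_hom ::
    "('a, 'c) cn_struct_scheme \<Rightarrow> ('b, 'd) cn_struct_scheme \<Rightarrow> ('a \<Rightarrow> 'b) set" where
  "cn_hom M N = {h \<in> carrier M \<rightarrow> carrier N.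
    (\<forall>x\<in>carrier M. \<forall>y\<in>carrier M.
      h (x \<sqinter>\<^bsub>M\<^esub> y) = h x \<sqinter>\<^bsub>N\<^esub> h y \<and> h (x \<leadsto>\<^bsub>M\<^esub> y) = h x \<leadsto>\<^bsub>N\<^esub> h y) \<and>
    (\<forall>x\<in>carrier M. h (\<sim>\<^bsub>M\<^esub> x) = \<sim>\<^bsub>N\<^esub> h x) \<and>
    h \<top>\<^bsub>M\<^esub> = \<top>\<^bsub>N\<^esub>}"

definition cn_iso ::
    "('a, 'c) cn_struct_scheme \<Rightarrow> ('b, 'd) cn_struct_scheme \<Rightarrow> ('a \<Rightarrow> 'b) set" where
  "cn_iso M N = {h \<in> cn_hom M N. bij_betw h (carrier M) (carrier N)}"

definition twist_map :: "('a, 'b) cn_struct_scheme \<Rightarrow> 'a \<Rightarrow> 'a \<times> 'a" where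
  "twist_map A a = (\<diamond>\<^bsub>A\<^esub> a, \<diamond>\<^bsub>A\<^esub> (\<sim>\<^bsub>A\<^esub> a))"

end

theory Submission
  imports Defs
begin

text \<open>
  The image of \<open>\<diamond>\<close> is the lower half \<open>{x. x \<sqsubseteq> \<top>}\<close>, and \<open>\<diamond> (\<sim> a)\<close> is a copy of
  the upper part of \<open>a\<close>: negating it gives \<open>a \<squnion> \<top>\<close>. So \<open>twist_map\<close> records the meet and the
  join of \<open>a\<close> with the center, and in a distributive lattice these determine \<open>a\<close>
  (\<open>eq_if_meet_join_eq\<close>); this is why the map is injective. It respects the operations because
  \<open>\<diamond>\<close> distributes over meets and joins, because CN4 lets \<open>\<diamond>\<close> pass through an
  implication, and because CN5 turns the second coordinate of an implication into one of the
  same shape. The Kleene inequality, applied with the center on its left, says that \<open>\<top>\<close> lies below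
  \<open>\<sim> a \<squnion> a\<close>, so that the two coordinates join to \<open>\<top>\<close>. The CN-twist-algebra sought is
  therefore the image of the map.

  The other half of the claim is that the elements below the center form a generalized Boolean
  algebra. Here the center is the only fixed point of negation, and CN5 makes \<open>x \<leadsto> \<top>\<close> a fixed
  point, so \<open>x \<leadsto> \<top> = \<top>\<close>. Below the center, CN6 makes \<open>\<top>\<close> a left unit of implication
  and gives modus ponens, and with this unit CN2 becomes \<open>y \<leadsto> y = \<top>\<close>. Hence implication
  internalizes the order there:
  \<open>x \<sqsubseteq> y\<close> exactly if \<open>x \<leadsto> y = \<top>\<close> (\<open>le_iff_imp_center\<close>). Residuation is then a rewriting of
  CN1, and Peirce's law a rewriting of CN3.
\<close>

section \<open>Distributive and Kleene lattices\<close>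

context distrib_lattice_on
begin

lemma meet_idem: "x \<in> L \<Longrightarrow> meet x x = x"
  by (metis join_absorb meet_absorb meet_closed)

lemma distrib_right:
  "x \<in> L \<Longrightarrow> y \<in> L \<Longrightarrow> z \<in> L \<Longrightarrow> meet (join x y) z = join (meet x z) (meet y z)"
  by (simp add: distrib join_closed meet_comm[of _ z])

text \<open>
  Both \<open>x\<close> and \<open>y\<close> equal \<open>(x \<and> y) \<or> (x \<and> t)\<close>: this is \<open>x \<and> (y \<or> t)\<close>, where \<open>y \<or> t\<close> may be
  replaced by \<open>x \<or> t\<close> and absorbed, and the same holds for \<open>y\<close>.
\<close>

lemma eq_if_meet_join_eq:
  assumes "x \<in> L" "y \<in> L" "t \<in> L" "meet x t = meet y t" "join x t = join y t"
  shows "x = y"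
proof -
  have "x = meet x (join y t)"
    using assms by (metis meet_absorb)
  also have "\<dots> = join (meet y x) (meet y t)"
    using assms by (metis distrib meet_comm)
  also have "\<dots> = meet y (join x t)"
    using distrib assms(1-3) by metis
  also have "\<dots> = y"
    using assms by (metis meet_absorb)
  finally show ?thesis .
qed

end

text \<open>
  If \<open>x\<close> is its own negation, then \<open>x \<and> \<not>x\<close> and \<open>x \<or> \<not>x\<close> both equal \<open>x\<close>, and likewise for the
  center. The Kleene inequality compares the two elements in both directions.
\<close>

lemma (in centered_kleene_lattice_on) neg_fixpoint_is_center:
  assumes "x \<in> L" "neg x = x"
  shows "x = center"
proof -
  have join_self: "join z z = z" if "z \<in> L" for z
    using that by (metis join_absorb meet_idem)
  have "meet x center = x" "meet center x = center"
    using kleene[of x center] kleene[of center x] assms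
    by (simp_all add: meet_le_def meet_idem join_self center_closed neg_center)
  then show ?thesis
    using assms center_closed meet_comm by metis
qed

section \<open>The elements below the center\<close>

context cn_algebra
begin

sublocale kl: centered_kleene_lattice_on "carrier M" "meet M" "cn_join M" "neg M" \<top>
  by (rule centered_kleene)

lemma diamond_closed: "x \<in> carrier M \<Longrightarrow> \<diamond> x \<in> carrier M"
  by (simp add: diamond_def kl.meet_closed kl.center_closed)

lemma mem_diamond_image_iff: "x \<in> diamond M ` carrier M \<longleftrightarrow> x \<in> carrier M \<and> \<diamond> x = x"
proof -
  have "\<diamond> (\<diamond> x) = \<diamond> x" if "x \<in> carrier M" for x
    using that by (simp add: diamond_def kl.meet_assoc kl.meet_idem kl.center_closed)
  then show ?thesis
    by (force simp: image_iff diamond_closed)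
qed

lemma diamond_center: "\<diamond> \<top> = \<top>"
  by (simp add: diamond_def kl.meet_idem kl.center_closed)

lemma diamond_meet:
  assumes "x \<in> carrier M" "y \<in> carrier M"
  shows "\<diamond> (x \<sqinter> y) = \<diamond> x \<sqinter> \<diamond> y"
proof -
  have "\<diamond> x \<sqinter> \<diamond> y = x \<sqinter> (\<top> \<sqinter> (\<diamond> y))"
    using assms by (simp add: diamond_def kl.meet_assoc kl.meet_closed kl.center_closed)
  also have "\<top> \<sqinter> (\<diamond> y) = y \<sqinter> \<top>"
    using assms
    by (metis diamond_def kl.meet_assoc kl.meet_closed kl.meet_comm kl.meet_idem kl.center_closed)
  finally show ?thesis
    using assms by (simp add: diamond_def kl.meet_assoc kl.center_closed)
qed

lemma diamond_join:
  "x \<in> carrier M \<Longrightarrow> y \<in> carrier M \<Longrightarrow> \<diamond> (cn_join M x y) = cn_join M (\<diamond> x) (\<diamond> y)"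
  by (simp add: diamond_def kl.distrib_right kl.center_closed)

lemma imp_center:
  assumes "x \<in> carrier M"
  shows "x \<leadsto> \<top> = \<top>"
  using assms
  by (intro kl.neg_fixpoint_is_center)
    (simp_all add: imp_closed CN5 kl.center_closed kl.neg_center)

text \<open>This is CN6 with the center in place of \<open>x\<close>, once CN4 has moved \<open>\<diamond>\<close> inside.\<close>

lemma center_imp:
  assumes "y \<in> carrier M" "\<diamond> y = y"
  shows "\<top> \<leadsto> y = y"
proof -
  have "\<top> \<leadsto> y = \<diamond> (\<top> \<leadsto> y)"
    using assms by (simp add: CN4 diamond_center kl.center_closed)
  also have "\<dots> = \<diamond> (\<top> \<sqinter> (\<top> \<leadsto> y))"
    using assms by (metis diamond_center diamond_closed diamond_def diamond_meet
        imp_closed kl.center_closed kl.meet_comm mem_diamond_image_iff image_eqI)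
  also have "\<dots> = \<diamond> (\<top> \<sqinter> y)"
    using assms by (metis CN6 kl.center_closed)
  also have "\<dots> = y"
    using assms by (metis diamond_def kl.center_closed kl.meet_comm)
  finally show ?thesis .
qed

lemma meet_imp:
  assumes "x \<in> carrier M" "\<diamond> x = x" "y \<in> carrier M" "\<diamond> y = y"
  shows "x \<sqinter> (x \<leadsto> y) = x \<sqinter> y"
  using assms CN6[of x y] by (simp add: diamond_meet imp_closed CN4)

lemma eq_center_if_center_le:
  assumes "x \<in> carrier M" "\<diamond> x = x" "\<top> \<sqsubseteq> x"
  shows "x = \<top>"
  using assms by (metis diamond_def kl.center_closed kl.meet_comm le_def meet_le_def)

lemma imp_self:
  assumes "y \<in> carrier M" "\<diamond> y = y"
  shows "y \<leadsto> y = \<top>"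
  using assms CN2[of \<top> y]
  by (simp add: center_imp eq_center_if_center_le imp_closed CN4 kl.center_closed)

text \<open>
  From right to left this is modus ponens. From left to right, \<open>x \<sqinter> y = x\<close> allows CN1 to rewrite
  \<open>x \<leadsto> y\<close> as \<open>x \<leadsto> (y \<leadsto> y)\<close>, that is, as \<open>x \<leadsto> \<top>\<close>.
\<close>

lemma le_iff_imp_center:
  assumes x: "x \<in> carrier M" "\<diamond> x = x" and y: "y \<in> carrier M" "\<diamond> y = y"
  shows "x \<sqsubseteq> y \<longleftrightarrow> x \<leadsto> y = \<top>"
proof
  assume "x \<sqsubseteq> y"
  then have "x \<leadsto> y = x \<leadsto> (y \<leadsto> y)"
    using x(1) y(1) by (metis CN1 le_def meet_le_def)
  then show "x \<leadsto> y = \<top>"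
    using x y by (simp add: imp_self imp_center)
next
  assume "x \<leadsto> y = \<top>"
  then show "x \<sqsubseteq> y"
    using meet_imp[OF x y] x(2) by (simp add: le_def meet_le_def diamond_def)
qed

lemma diamond_residuation:
  assumes "x \<in> carrier M" "\<diamond> x = x" "y \<in> carrier M" "\<diamond> y = y" "z \<in> carrier M" "\<diamond> z = z"
  shows "x \<sqinter> y \<sqsubseteq> z \<longleftrightarrow> y \<sqsubseteq> x \<leadsto> z"
proof -
  have "x \<sqinter> y \<sqsubseteq> z \<longleftrightarrow> (y \<sqinter> x) \<leadsto> z = \<top>"
    using assms
    by (simp add: le_iff_imp_center diamond_meet kl.meet_closed kl.meet_comm[of y x])
  also have "\<dots> \<longleftrightarrow> y \<sqsubseteq> x \<leadsto> z"
    using assms by (simp add: CN1 le_iff_imp_center imp_closed CN4)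
  finally show ?thesis .
qed

lemma diamond_peirce:
  assumes x: "x \<in> carrier M" "\<diamond> x = x" and y: "y \<in> carrier M" "\<diamond> y = y"
  shows "(x \<leadsto> y) \<leadsto> x = x"
proof -
  have "(x \<leadsto> y) \<leadsto> x \<sqsubseteq> x"
    using x y CN3[of x y] by (simp add: le_iff_imp_center eq_center_if_center_le imp_closed CN4)
  moreover have "(x \<leadsto> y) \<sqinter> x \<sqsubseteq> x"
    using x y by (simp add: le_def meet_le_def kl.meet_assoc kl.meet_idem imp_closed)
  then have "x \<sqsubseteq> (x \<leadsto> y) \<leadsto> x"
    using x y by (simp add: diamond_residuation imp_closed CN4)
  ultimately show ?thesis
    using x(1) y(1) by (metis imp_closed kl.meet_comm le_def meet_le_def)
qed

lemma generalized_boolean_diamond_algebra: "generalized_boolean_algebra (diamond_algebra M)"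
proof (rule generalized_boolean_algebra.intro)
  fix x y z
  note [simp] = diamond_algebra_def le_def mem_diamond_image_iff
  assume "x \<in> carrier (diamond_algebra M)"
  then have x: "x \<in> carrier M" "\<diamond> x = x" by simp_all
  show "x \<sqsubseteq>\<^bsub>diamond_algebra M\<^esub> \<top>\<^bsub>diamond_algebra M\<^esub>"
    using x(2) by (simp add: meet_le_def diamond_def)
  assume "y \<in> carrier (diamond_algebra M)"
  then have y: "y \<in> carrier M" "\<diamond> y = y" by simp_all
  show "x \<leadsto>\<^bsub>diamond_algebra M\<^esub> y \<in> carrier (diamond_algebra M)"
    using x y by (simp add: imp_closed CN4)
  show "(x \<leadsto>\<^bsub>diamond_algebra M\<^esub> y) \<leadsto>\<^bsub>diamond_algebra M\<^esub> x = x"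
    using x y by (simp add: diamond_peirce)
  assume "z \<in> carrier (diamond_algebra M)"
  then have z: "z \<in> carrier M" "\<diamond> z = z" by simp_all
  show "x \<sqinter>\<^bsub>diamond_algebra M\<^esub> y \<sqsubseteq>\<^bsub>diamond_algebra M\<^esub> z \<longleftrightarrow>
      y \<sqsubseteq>\<^bsub>diamond_algebra M\<^esub> x \<leadsto>\<^bsub>diamond_algebra M\<^esub> z"
    using diamond_residuation[OF x y z] by simp
next
  show "\<top>\<^bsub>diamond_algebra M\<^esub> \<in> carrier (diamond_algebra M)"
    by (simp add: diamond_algebra_def mem_diamond_image_iff kl.center_closed diamond_center)
next
  show "lattice_on (carrier (diamond_algebra M)) (meet (diamond_algebra M))
      (gjoin (diamond_algebra M))"
    by unfold_locales
      (auto simp: diamond_algebra_def mem_diamond_image_iff diamond_meet diamond_join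
        kl.meet_closed kl.join_closed kl.meet_assoc kl.join_assoc kl.meet_absorb kl.join_absorb
        intro: kl.meet_comm kl.join_comm)
qed

section \<open>The twist map\<close>

text \<open>
  The coordinates join to \<open>\<diamond> (a \<squnion> \<sim> a)\<close>, and the center lies below \<open>\<sim> a \<squnion> a\<close> by the Kleene
  inequality.
\<close>

lemma twist_map_in_full_twist:
  assumes "a \<in> carrier M"
  shows "twist_map M a \<in> carrier (full_twist (diamond_algebra M))"
proof -
  have "cn_join M (\<diamond> a) (\<diamond> (\<sim> a)) = \<diamond> (cn_join M (\<sim> a) a)"
    using assms by (simp add: diamond_join kl.neg_closed kl.join_comm)
  also have "\<dots> = \<top>"
    using assms kl.kleene[of \<top> a]
    by (simp add: diamond_def meet_le_def kl.neg_center kl.meet_idem kl.center_closed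
        kl.meet_comm[of _ \<top>] kl.join_closed kl.neg_closed)
  finally show ?thesis
    using assms
    by (simp add: twist_map_def full_twist_def diamond_algebra_def kl.neg_closed)
qed

lemma twist_map_hom: "twist_map M \<in> cn_hom M (full_twist (diamond_algebra M))"
  unfolding cn_hom_def
  by (auto simp: twist_map_in_full_twist)
    (simp_all add: twist_map_def full_twist_def diamond_algebra_def diamond_meet diamond_join
      kl.de_morgan kl.neg_closed kl.neg_neg kl.neg_center diamond_center CN4 CN5)

text \<open>
  Equal second coordinates \<open>\<sim> a \<sqinter> \<top> = \<sim> b \<sqinter> \<top>\<close> become \<open>a \<squnion> \<top> = b \<squnion> \<top>\<close> under negation,
  because the center is its own negation.
\<close>

lemma inj_on_twist_map: "inj_on (twist_map M) (carrier M)"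
proof (rule inj_onI)
  fix a b
  assume ab: "a \<in> carrier M" "b \<in> carrier M" and eq: "twist_map M a = twist_map M b"
  have "a \<sqinter> \<top> = b \<sqinter> \<top>" and "\<sim> a \<sqinter> \<top> = \<sim> b \<sqinter> \<top>"
    using eq by (simp_all add: twist_map_def diamond_def)
  moreover from this(2) have "cn_join M a \<top> = cn_join M b \<top>"
    by (simp add: cn_join_def kl.neg_center)
  ultimately show "a = b"
    using ab kl.eq_if_meet_join_eq kl.center_closed by blast
qed

end

lemma cn_subalgebra_hom_image:
  fixes N :: "'b cn_struct"
  assumes "cn_algebra M" and h: "h \<in> cn_hom M N"
  shows "cn_subalgebra (N\<lparr>carrier := h ` carrier M\<rparr>) N"
proof -
  interpret cn_algebra M by fact
  have hom: "h \<in> carrier M \<rightarrow> carrier N"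
    "\<And>x y. x \<in> carrier M \<Longrightarrow> y \<in> carrier M \<Longrightarrow> h x \<sqinter>\<^bsub>N\<^esub> h y = h (x \<sqinter>\<^bsub>M\<^esub> y)"
    "\<And>x y. x \<in> carrier M \<Longrightarrow> y \<in> carrier M \<Longrightarrow> h x \<leadsto>\<^bsub>N\<^esub> h y = h (x \<leadsto>\<^bsub>M\<^esub> y)"
    "\<And>x. x \<in> carrier M \<Longrightarrow> \<sim>\<^bsub>N\<^esub> h x = h (\<sim>\<^bsub>M\<^esub> x)" "\<top>\<^bsub>N\<^esub> = h \<top>\<^bsub>M\<^esub>"
    using h by (simp_all add: cn_hom_def)
  then show ?thesis
    by (auto simp: cn_subalgebra_def kl.meet_closed kl.neg_closed kl.center_closed imp_closed)
qed

theorem theorem39: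
  fixes A :: "'a cn_struct"
  assumes "cn_algebra A"
  shows "\<exists>C. cn_twist_algebra_over C (diamond_algebra A) \<and> twist_map A \<in> cn_iso A C"
proof -
  interpret cn_algebra A by fact
  let ?N = "full_twist (diamond_algebra A)"
  let ?C = "?N\<lparr>carrier := twist_map A ` carrier A\<rparr>"
  have "fst ` carrier ?C = carrier (diamond_algebra A)"
    by (simp add: image_image twist_map_def diamond_algebra_def)
  then have "cn_twist_algebra_over ?C (diamond_algebra A)"
    using generalized_boolean_diamond_algebra cn_subalgebra_hom_image[OF assms twist_map_hom]
    by (simp add: cn_twist_algebra_over_def)
  moreover have "twist_map A \<in> cn_iso A ?C"
    using twist_map_hom inj_on_twist_map
    by (simp add: cn_iso_def cn_hom_def bij_betw_def)
  ultimately show ?thesis by blast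
qed

end
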